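(* For every positive integer $p$ and every $x\in[0,1]$, $$\varphi_{p,n}(x)=\varPhi_p(x)+O(Q_p^n)\qquad (n\to\infty),$$ where $$Q_p=2p^2\zeta(3,p)-p\,\zeta(2,p)<\frac{1}{2p}+\frac{3}{8p^2}<1 .$$ That is, for every positive integer $p$ the displayed inequalities for $Q_p$ hold, and for every positive integer $p$ and every $x\in[0,1]$ there is a constant $C$ (which may depend on $p$ and $x$ but not on $n$) such that $|\varphi_{p,n}(x)-\varPhi_p(x)|\le C\,Q_p^n$ for all $n\ge 0$.
   Context: For a positive integer $p$, the generalized Gauss transformation $T_p:[0,1]\to[0,1]$ is defined by $T_p(0)=0$ and $T_p(x)=\{p/x\}$ for $x\neq 0$, where $\{\cdot\}$ denotes the fractional part. Let $m$ be the Lebesgue measure on $[0,1]$. For $n\ge 0$ and $x\in[0,1]$ put $$\varphi_{p,n}(x)=m\big(T_p^{-n}([0,x])\big),$$ where $T_p^{-n}(A)$ is the preimage of $A$ under the $n$-fold iterate of $T_p$ (so $\varphi_{p,0}(x)=x$), and $$\varPhi_p(x)=\frac{\ln(p+x)-\ln p}{\ln(p+1)-\ln p}.$$ The Hurwitz zeta values are $\zeta(2,p)=\sum_{k=p}^\infty \frac{1}{k^2}$ and $\zeta(3,p)=\sum_{k=p}^\infty\frac{1}{k^3}$. *)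

theory Defs
  imports "HOL-Analysis.Analysis"
begin

text \<open>The map is total on the reals; only its values on \<open>[0,1]\<close>, which it maps into itself,
  are ever used.\<close>
definition gauss_map :: "nat \<Rightarrow> real \<Rightarrow> real" where
  "gauss_map p x = (if x = 0 then 0 else frac (real p / x))"

text \<open>Preimages are taken within the domain \<open>[0,1]\<close>, hence the intersection.\<close>
definition gauss_distr :: "nat \<Rightarrow> nat \<Rightarrow> real \<Rightarrow> real" where
  "gauss_distr p n x =
     measure (lebesgue_on {0..1}) ((gauss_map p ^^ n) -` {0..x} \<inter> {0..1})"

definition gauss_limit :: "nat \<Rightarrow> real \<Rightarrow> real" where
  "gauss_limit p x = (ln (real p + x) - ln (real p)) / (ln (real p + 1) - ln (real p))"

text \<open>The Hurwitz zeta value \<open>\<zeta>(s,p) = \<Sum>k\<ge>p. 1 / k ^ s\<close> for integers \<open>s \<ge> 2\<close> and \<open>p \<ge> 1\<close>,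
  with the summation index shifted to start at \<open>0\<close>.\<close>
definition hurwitz_zeta_nat :: "nat \<Rightarrow> nat \<Rightarrow> real" where
  "hurwitz_zeta_nat s p = (\<Sum>k. 1 / real (k + p) ^ s)"

definition gauss_rate :: "nat \<Rightarrow> real" where
  "gauss_rate p = 2 * real p ^ 2 * hurwitz_zeta_nat 3 p - real p * hurwitz_zeta_nat 2 p"

end

theory Submission
  imports Defs "HOL-Real_Asymp.Real_Asymp"
begin

text \<open>The measure with density \<open>1 / (p + x)\<close> is invariant under \<open>T\<^sub>p\<close>, and \<open>\<Phi>\<^sub>p\<close> is its normalised
  distribution function. So write the density of the law of \<open>T\<^sub>p\<^sup>n\<close> as \<open>f\<^sub>n(x) / (p + x)\<close>. The
  branches of the inverse of \<open>T\<^sub>p\<close> are \<open>u\<^sub>k(x) = p / (k + x)\<close>, \<open>k \<ge> p\<close>, and the transfer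
  operator turns into the averaging operator
  \<open>f\<^sub>n\<^sub>+\<^sub>1(x) = \<Sum>k\<ge>p. P\<^sub>k(x) f\<^sub>n(u\<^sub>k(x))\<close> with the probability weights
  \<open>P\<^sub>k(x) = (p + x) / ((k + x) (k + x + 1))\<close>, starting from \<open>f\<^sub>0(x) = p + x\<close>, whose Lipschitz
  constant is 1.

  The heart of the matter is that this operator multiplies Lipschitz constants by at most
  \<open>Q\<^sub>p\<close> (lemma \<open>gauss_op_lipschitz\<close>). There are two contributions: the branches contract, and the
  weights vary with \<open>x\<close>. Since \<open>P\<^sub>k\<close> is a difference \<open>B\<^sub>k\<^sub>+\<^sub>1 - B\<^sub>k\<close> with
  \<open>B\<^sub>k(x) = (k - p) / (k + x)\<close>, summation by parts makes the second contribution depend only on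
  differences \<open>f(u\<^sub>k) - f(u\<^sub>k\<^sub>+\<^sub>1)\<close>, so that the Lipschitz constant of \<open>f\<close> controls it as well. The
  total is a series of functions of \<open>x\<close>, each of which is largest at \<open>0\<close> (\<open>lip_coeff_le\<close>), and its
  sum at \<open>0\<close> is exactly \<open>Q\<^sub>p\<close> (\<open>lip_coeff_0_sums\<close>). Working with difference quotients rather than with
  derivatives avoids any question of smoothness of \<open>f\<^sub>n\<close>.

  Hence \<open>f\<^sub>n\<close> oscillates by at most \<open>Q\<^sub>p\<^sup>n\<close> on \<open>[0,1]\<close>. By the mean value theorem
  \<open>\<phi>\<^sub>p\<^sub>,\<^sub>n(x) = f\<^sub>n(\<eta>) (ln (p + x) - ln p)\<close> for some \<open>\<eta>\<close>, and the case \<open>x = 1\<close>, where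
  \<open>\<phi>\<^sub>p\<^sub>,\<^sub>n(1) = 1\<close>, gives a \<open>\<xi>\<close> with \<open>f\<^sub>n(\<xi>) = 1 / (ln (p + 1) - ln p)\<close>. The error is therefore
  \<open>\<bar>f\<^sub>n(\<eta>) - f\<^sub>n(\<xi>)\<bar> (ln (p + x) - ln p)\<close>, which is at most a constant times \<open>Q\<^sub>p\<^sup>n\<close>.

  The upper bound for \<open>Q\<^sub>p\<close> comes from telescoping Euler--Maclaurin estimates of the two zeta
  values. Throughout, the summation index is \<open>i = k - p\<close>.\<close>

section \<open>Inverse branches, weights and the contraction coefficient\<close>

definition gauss_branch :: "nat \<Rightarrow> nat \<Rightarrow> real \<Rightarrow> real" where
  "gauss_branch p i x = real p / (real (i + p) + x)"

definition gauss_weight :: "nat \<Rightarrow> nat \<Rightarrow> real \<Rightarrow> real" where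
  "gauss_weight p i x = (real p + x) / ((real (i + p) + x) * (real (i + p) + x + 1))"

definition gauss_op :: "nat \<Rightarrow> (real \<Rightarrow> real) \<Rightarrow> real \<Rightarrow> real" where
  "gauss_op p f x = (\<Sum>i. gauss_weight p i x * f (gauss_branch p i x))"

text \<open>The share of the \<open>i\<close>-th branch in the Lipschitz constant of \<^term>\<open>gauss_op p f\<close> near \<open>x\<close>, for a
  1-Lipschitz \<open>f\<close>. The first summand is due to the variation of the weights, the second to
  the contraction of the branch.\<close>
definition lip_coeff :: "nat \<Rightarrow> nat \<Rightarrow> real \<Rightarrow> real" where
  "lip_coeff p i x = real p *
     ((real i + 1) / ((real (i + p) + x) * (real (i + p) + x + 1) ^ 3)
      + (real p + x) / ((real (i + p) + x) ^ 3 * (real (i + p) + x + 1)))"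

section \<open>The rate as a sum of contraction coefficients\<close>

lemma summable_hurwitz_zeta_nat:
  assumes "p \<ge> 1" "s \<ge> 2"
  shows "summable (\<lambda>k. 1 / real (k + p) ^ s)"
proof -
  have "summable (\<lambda>k. inverse (real k ^ s))"
    using inverse_power_summable[OF assms(2), where ?'a = real] by simp
  then have "summable (\<lambda>k. inverse (real (k + p) ^ s))"
    by (subst summable_iff_shift)
  then show ?thesis by (simp add: field_simps)
qed

lemma gauss_rate_sums:
  assumes "p \<ge> 1"
  shows "(\<lambda>k. 2 * real p ^ 2 * (1 / real (k + p) ^ 3) - real p * (1 / real (k + p) ^ 2)) sums gauss_rate p"
  unfolding gauss_rate_def hurwitz_zeta_nat_def
  by (intro sums_diff sums_mult summable_sums summable_hurwitz_zeta_nat[OF assms]) simp_all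

text \<open>Partial fractions turn \<open>lip_coeff p i 0\<close> into the terms of \<open>Q\<^sub>p\<close> plus a difference of consecutive
  values of a sequence that vanishes both at \<open>0\<close> and in the limit.\<close>
lemma lip_coeff_0_sums:
  assumes "p \<ge> 1"
  shows "(\<lambda>i. lip_coeff p i 0) sums gauss_rate p"
proof -
  define w :: "nat \<Rightarrow> real" where "w i = (let k = real (i + p) in
     real p * (1 / k + 1 / k ^ 2 - real p / k ^ 2 - real p / k ^ 3))" for i
  have "w \<longlonglongrightarrow> 0"
    unfolding w_def Let_def by real_asymp
  then have tel: "(\<lambda>i. w i - w (Suc i)) sums (w 0 - 0)"
    by (rule telescope_sums')
  have w0: "w 0 = 0"
    using assms by (simp add: w_def field_simps power2_eq_square power3_eq_cube)
  have "lip_coeff p i 0 = (2 * real p ^ 2 * (1 / real (i + p) ^ 3) - real p * (1 / real (i + p) ^ 2))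
      + (w i - w (Suc i))" for i
  proof -
    define k where "k = real (i + p)"
    have k: "k > 0" using assms by (simp add: k_def)
    have i: "real i = k - real p" by (simp add: k_def)
    have ks: "real (Suc i + p) = k + 1" by (simp add: k_def)
    define u where "u = 1 / k"
    define v where "v = 1 / (k + 1)"
    have uv: "u * v = u - v" and kv: "(k + 1) * v = 1"
      using k by (simp_all add: u_def v_def field_simps)
    have uv2: "u * v ^ 2 = u - v - v ^ 2" and uv3: "u * v ^ 3 = u - v - v ^ 2 - v ^ 3"
      and u3v: "u ^ 3 * v = u ^ 3 - u ^ 2 + u - v"
      using uv by algebra+
    have "(real i + 1) * (u * v ^ 3) = u * v ^ 2 - real p * (u * v ^ 3)"
      unfolding i using kv by algebra
    then have "lip_coeff p i 0 = real p * (u * v ^ 2 - real p * (u * v ^ 3) + real p * (u ^ 3 * v))"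
      unfolding lip_coeff_def k_def[symmetric] by (simp add: u_def v_def power_one_over)
    also have "\<dots> = 2 * real p ^ 2 * u ^ 3 - real p * u ^ 2
        + (real p * (u + u ^ 2 - real p * u ^ 2 - real p * u ^ 3)
           - real p * (v + v ^ 2 - real p * v ^ 2 - real p * v ^ 3))"
      unfolding uv2 uv3 u3v by (simp add: algebra_simps power2_eq_square)
    finally show ?thesis
      unfolding w_def Let_def ks k_def[symmetric] by (simp add: u_def v_def power_one_over)
  qed
  then show ?thesis
    using sums_add[OF gauss_rate_sums[OF assms] tel] w0 by simp
qed

lemma lip_coeff_nonneg:
  assumes "p \<ge> 1" "x \<ge> 0"
  shows "lip_coeff p i x \<ge> 0"
  using assms by (simp add: lip_coeff_def)

lemma gauss_rate_nonneg:
  assumes "p \<ge> 1"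
  shows "gauss_rate p \<ge> 0"
  using sums_le[OF _ sums_zero lip_coeff_0_sums[OF assms]] lip_coeff_nonneg[OF assms] by simp

text \<open>The two summands of \<^const>\<open>lip_coeff\<close> do not both decrease in \<open>x\<close>: for large \<open>k\<close> the second one grows
  with \<open>p + x\<close>. Only their sum does, as one sees by writing it as a function \<open>h\<close> of
  \<open>a = k + x\<close> for fixed \<open>i = k - p\<close>, where \<open>p \<ge> 1\<close> becomes \<open>i \<le> a - 1\<close>.\<close>
lemma lip_coeff_le:
  assumes p: "p \<ge> 1" and x: "x \<ge> 0"
  shows "lip_coeff p i x \<le> lip_coeff p i 0"
proof -
  define k where "k = real (i + p)"
  define h where "h a = (a ^ 3 + 3 * a ^ 2 + a - real i * (2 * a + 1)) / (a * (a + 1)) ^ 3" for a :: real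
  have k: "k \<ge> real i + 1" using p by (simp add: k_def)
  have eq: "lip_coeff p i y = real p * h (k + y)" if y: "y \<ge> 0" for y
  proof -
    define a where "a = k + y"
    have a: "a > 0" using k y by (simp add: a_def)
    have q: "real p + y = a - real i" by (simp add: a_def k_def)
    have "(real i + 1) / (a * (a + 1) ^ 3) = (real i + 1) * a ^ 2 / (a * (a + 1)) ^ 3"
      using a by (simp add: power_mult_distrib power2_eq_square power3_eq_cube)
    moreover have "(a - real i) / (a ^ 3 * (a + 1)) = (a - real i) * (a + 1) ^ 2 / (a * (a + 1)) ^ 3"
      using a by (simp add: power_mult_distrib power2_eq_square power3_eq_cube)
    moreover have "(real i + 1) * a ^ 2 + (a - real i) * (a + 1) ^ 2
        = a ^ 3 + 3 * a ^ 2 + a - real i * (2 * a + 1)"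
      by (simp add: algebra_simps power2_eq_square power3_eq_cube)
    ultimately show ?thesis
      unfolding lip_coeff_def h_def k_def[symmetric] a_def[symmetric] q
      by (simp add: add_divide_distrib[symmetric])
  qed
  have "h (k + x) \<le> h k"
  proof (rule DERIV_nonpos_imp_nonincreasing[where f = h])
    show "k \<le> k + x" using x by simp
    fix a assume a: "k \<le> a" "a \<le> k + x"
    have a1: "a \<ge> real i + 1" using a k by linarith
    have a0: "a > 0" using a1 by simp
    \<comment> \<open>\<open>r\<close> and \<open>m ^ 3\<close> are numerator and denominator of \<open>h\<close>, and \<open>r'\<close> is the derivative of \<open>r\<close>.\<close>
    define m where "m = a * (a + 1)"
    define r where "r = a ^ 3 + 3 * a ^ 2 + a - real i * (2 * a + 1)"
    define r' where "r' = 3 * a ^ 2 + 6 * a + 1 - 2 * real i"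
    define D where "D = (r' * m ^ 3 - r * (3 * m ^ 2 * (2 * a + 1))) / (m ^ 3 * m ^ 3)"
    have m: "m > 0" using a0 by (simp add: m_def)
    have num: "((\<lambda>a. a ^ 3 + 3 * a ^ 2 + a - real i * (2 * a + 1)) has_real_derivative r') (at a)"
      unfolding r'_def by (auto intro!: derivative_eq_intros)
    have den: "((\<lambda>a. (a * (a + 1)) ^ 3) has_real_derivative 3 * m ^ 2 * (2 * a + 1)) (at a)"
      unfolding m_def by (auto intro!: derivative_eq_intros)
    have "(a * (a + 1)) ^ 3 \<noteq> 0" using a0 by simp
    from DERIV_divide[OF num den this] have "(h has_real_derivative D) (at a)"
      unfolding h_def D_def m_def r_def .
    moreover have "D \<le> 0"
    proof -
      define N where "N = 3 * a ^ 4 + 12 * a ^ 3 + 8 * a ^ 2 + 2 * a - real i * (10 * a ^ 2 + 10 * a + 3)"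
      have "real i * (10 * a ^ 2 + 10 * a + 3) \<le> (a - 1) * (10 * a ^ 2 + 10 * a + 3)"
        using a1 a0 by (intro mult_right_mono) auto
      also have "\<dots> = 10 * a ^ 3 - 7 * a - 3"
        by (simp add: algebra_simps power2_eq_square power3_eq_cube)
      also have "\<dots> \<le> 12 * a ^ 3 + 2 * a"
        using a0 zero_le_power[of a 3] by linarith
      also have "\<dots> \<le> 3 * a ^ 4 + 12 * a ^ 3 + 8 * a ^ 2 + 2 * a"
        using a0 by simp
      finally have N: "N \<ge> 0" by (simp add: N_def)
      have "r' * m - 3 * r * (2 * a + 1) = - N"
        unfolding r'_def m_def r_def N_def by algebra
      moreover have "r' * m ^ 3 - r * (3 * m ^ 2 * (2 * a + 1)) = m ^ 2 * (r' * m - 3 * r * (2 * a + 1))"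
        by algebra
      ultimately have "D = - (m ^ 2 * N) / (m ^ 3 * m ^ 3)"
        by (simp add: D_def)
      then show ?thesis using N m by simp
    qed
    ultimately show "\<exists>y. (h has_real_derivative y) (at a) \<and> y \<le> 0" by blast
  qed
  then show ?thesis
    using eq[OF x] eq[of 0] by (simp add: mult_left_mono)
qed

text \<open>\<open>G\<close> and \<open>H\<close> are truncated Euler--Maclaurin expansions of \<open>\<zeta>(3,k)\<close> and \<open>\<zeta>(2,k)\<close>, bounding them from
  above and from below; one checks this on the increments from \<open>k\<close> to \<open>k + 1\<close>. The exact
  expansion of \<open>\<zeta>(2,k)\<close> has \<open>1 / (6 k\<^sup>3)\<close> in place of \<open>1 / (8 k\<^sup>3)\<close>, with a negative next term; the
  smaller constant gives a lower bound for every \<open>k \<ge> 1\<close> and makes \<open>V 0\<close> equal to the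
  claimed bound.\<close>
lemma gauss_rate_less:
  assumes p: "p \<ge> 1"
  shows "gauss_rate p < 1 / (2 * real p) + 3 / (8 * real p ^ 2)"
proof -
  define G where "G k = 1 / (2 * k ^ 2) + 1 / (2 * k ^ 3) + 1 / (4 * k ^ 4)" for k :: real
  define H where "H k = 1 / k + 1 / (2 * k ^ 2) + 1 / (8 * k ^ 3)" for k :: real
  define V where "V i = 2 * real p ^ 2 * G (real (i + p)) - real p * H (real (i + p))" for i
  have "V \<longlonglongrightarrow> 0"
    unfolding V_def G_def H_def by real_asymp
  then have tel: "(\<lambda>i. V i - V (Suc i)) sums (V 0 - 0)"
    by (rule telescope_sums')
  have G: "1 / k ^ 3 < G k - G (k + 1)" if k: "k \<ge> 1" for k
  proof -
    have G_frac: "G a = (2 * a ^ 2 + 2 * a + 1) / (4 * a ^ 4)" if "a > 0" for a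
      using that by (simp add: G_def field_simps power2_eq_square power3_eq_cube power4_eq_xxxx)
    have "1 / k ^ 3 = 4 * k / (4 * k ^ 4)"
      using k by (simp add: power3_eq_cube power4_eq_xxxx)
    then have "G k - G (k + 1) - 1 / k ^ 3
        = (2 * k ^ 2 - 2 * k + 1) / (4 * k ^ 4) - (2 * (k + 1) ^ 2 + 2 * (k + 1) + 1) / (4 * (k + 1) ^ 4)"
      using k by (simp add: G_frac diff_divide_distrib add_divide_distrib)
    also have "\<dots> = (2 * k + 1) / (4 * k ^ 4 * (k + 1) ^ 4)"
      using k by (simp add: diff_frac_eq frac_eq_eq) algebra
    also have "\<dots> > 0" using k by (intro divide_pos_pos) (auto simp: add_pos_pos)
    finally show ?thesis by simp
  qed
  have H: "H k - H (k + 1) < 1 / k ^ 2" if k: "k \<ge> 1" for k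
  proof -
    have H_frac: "H a = (8 * a ^ 2 + 4 * a + 1) / (8 * a ^ 3)" if "a > 0" for a
      using that by (simp add: H_def field_simps power2_eq_square power3_eq_cube)
    have "1 / k ^ 2 = 8 * k / (8 * k ^ 3)"
      using k by (simp add: power2_eq_square power3_eq_cube)
    then have "1 / k ^ 2 - (H k - H (k + 1))
        = (8 * (k + 1) ^ 2 + 4 * (k + 1) + 1) / (8 * (k + 1) ^ 3) - (8 * k ^ 2 - 4 * k + 1) / (8 * k ^ 3)"
      using k by (simp add: H_frac diff_divide_distrib add_divide_distrib)
    also have "\<dots> = (k * (k + 1) - 1) / (8 * k ^ 3 * (k + 1) ^ 3)"
      using k by (simp add: diff_frac_eq frac_eq_eq) algebra
    also have "\<dots> > 0"
    proof (intro divide_pos_pos)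
      have "1 * (1 + 1) \<le> k * (k + 1)" using k by (intro mult_mono) auto
      then show "k * (k + 1) - 1 > 0" by simp
    qed (use k in auto)
    finally show ?thesis by simp
  qed
  define t where "t i = 2 * real p ^ 2 * (1 / real (i + p) ^ 3) - real p * (1 / real (i + p) ^ 2)" for i
  have lt: "t i < V i - V (Suc i)" for i
  proof -
    define k where "k = real (i + p)"
    have k: "k \<ge> 1" using p by (simp add: k_def)
    have ks: "real (Suc i + p) = k + 1" by (simp add: k_def)
    have "2 * real p ^ 2 * (1 / k ^ 3) < 2 * real p ^ 2 * (G k - G (k + 1))"
      using G[OF k] p by (intro mult_strict_left_mono) auto
    moreover have "real p * (H k - H (k + 1)) < real p * (1 / k ^ 2)"
      using H[OF k] p by (intro mult_strict_left_mono) auto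
    ultimately show ?thesis
      unfolding t_def V_def ks k_def[symmetric] by (simp add: algebra_simps)
  qed
  have "(\<lambda>i. V i - V (Suc i) - t i) sums (V 0 - 0 - gauss_rate p)"
    using sums_diff[OF tel gauss_rate_sums[OF p]] by (simp add: t_def)
  then have "V 0 - gauss_rate p > 0"
    using lt suminf_pos[of "\<lambda>i. V i - V (Suc i) - t i"]
    by (simp add: sums_iff)
  moreover have "V 0 = 1 / (2 * real p) + 3 / (8 * real p ^ 2)"
    unfolding V_def G_def H_def using p by (simp add: divide_simps) algebra
  ultimately show ?thesis by simp
qed

lemma gauss_rate_bound_less_1:
  assumes "p \<ge> 1"
  shows "1 / (2 * real p) + 3 / (8 * real p ^ 2) < 1"
proof -
  have "1 / (2 * real p) \<le> 1 / 2" "3 / (8 * real p ^ 2) \<le> 3 / 8"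
    using assms by (simp_all add: divide_simps)
  then show ?thesis by linarith
qed

section \<open>Contraction of the Lipschitz constant\<close>

lemma gauss_branch_in_unit:
  assumes "p \<ge> 1" "x \<ge> 0"
  shows "gauss_branch p i x \<in> {0..1}"
proof -
  have "real (i + p) + x > 0" using assms by (simp add: add_pos_nonneg)
  then show ?thesis using assms by (simp add: gauss_branch_def)
qed

lemma gauss_weight_bounds:
  assumes "p \<ge> 1" "x \<in> {0..1}"
  shows "0 \<le> gauss_weight p i x" "gauss_weight p i x \<le> (real p + 1) * (1 / real (i + p) ^ 2)"
proof -
  show "0 \<le> gauss_weight p i x" using assms by (simp add: gauss_weight_def)
  have "gauss_weight p i x \<le> (real p + 1) / (real (i + p) * real (i + p))"
    unfolding gauss_weight_def using assms by (intro frac_le mult_mono) auto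
  then show "gauss_weight p i x \<le> (real p + 1) * (1 / real (i + p) ^ 2)"
    by (simp add: power2_eq_square)
qed

lemma gauss_op_term_bound:
  assumes "p \<ge> 1" "x \<in> {0..1}" "\<And>y. y \<in> {0..1} \<Longrightarrow> \<bar>f y\<bar> \<le> B"
  shows "\<bar>gauss_weight p i x * f (gauss_branch p i x)\<bar> \<le> (real p + 1) * B * (1 / real (i + p) ^ 2)"
proof -
  have "\<bar>gauss_weight p i x\<bar> * \<bar>f (gauss_branch p i x)\<bar> \<le> ((real p + 1) * (1 / real (i + p) ^ 2)) * B"
    using assms gauss_weight_bounds[OF assms(1,2)] gauss_branch_in_unit[OF assms(1)]
    by (intro mult_mono) auto
  then show ?thesis by (simp add: abs_mult mult_ac)
qed

lemma gauss_op_sums: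
  assumes "p \<ge> 1" "x \<in> {0..1}" "\<And>y. y \<in> {0..1} \<Longrightarrow> \<bar>f y\<bar> \<le> B"
  shows "(\<lambda>i. gauss_weight p i x * f (gauss_branch p i x)) sums gauss_op p f x"
  unfolding gauss_op_def
proof (rule summable_sums, rule summable_comparison_test')
  show "summable (\<lambda>i. (real p + 1) * B * (1 / real (i + p) ^ 2))"
    using assms(1) by (intro summable_mult summable_hurwitz_zeta_nat) auto
qed (use gauss_op_term_bound[OF assms] in auto)

lemma lipschitz_on_unit_bounded:
  fixes f :: "real \<Rightarrow> real"
  assumes "L-lipschitz_on {0..1} f"
  obtains B where "\<And>y. y \<in> {0..1} \<Longrightarrow> \<bar>f y\<bar> \<le> B"
proof -
  have "bounded (f ` {0..1})"
    by (intro compact_imp_bounded compact_continuous_image compact_Icc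
        lipschitz_on_continuous_on[OF assms])
  then obtain B where "\<forall>z\<in>f ` {0..1}. norm z \<le> B"
    unfolding bounded_iff by blast
  then have "\<bar>f y\<bar> \<le> B" if "y \<in> {0..1}" for y
    using that by simp
  then show ?thesis by (rule that)
qed

text \<open>For \<open>x \<le> y\<close> the \<open>i\<close>-th terms of the two series differ by \<open>e i\<close> plus an increment of \<open>c i * g i\<close>.
  The increments sum to zero because \<open>c 0 = 0\<close>, \<open>c\<close> tends to \<open>0\<close> and \<open>g\<close> is bounded: this is
  summation by parts. In \<open>e i\<close> only differences of values of \<open>f\<close> occur, and replacing \<open>y\<close> by
  the smaller \<open>x\<close> in the denominators bounds it by the contraction coefficient at \<open>x\<close>.\<close>
lemma gauss_op_lipschitz:
  assumes p: "p \<ge> 1" and L: "L-lipschitz_on {0..1} f"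
  shows "(gauss_rate p * L)-lipschitz_on {0..1} (gauss_op p f)"
proof (rule lipschitz_on_leI)
  have L0: "L \<ge> 0" using L by (rule lipschitz_on_nonneg)
  then show "0 \<le> gauss_rate p * L" using gauss_rate_nonneg[OF p] by simp
  obtain B where B: "\<And>y. y \<in> {0..1} \<Longrightarrow> \<bar>f y\<bar> \<le> B"
    using lipschitz_on_unit_bounded[OF L] by blast
  fix x y :: real assume x: "x \<in> {0..1}" and y: "y \<in> {0..1}" and xy: "x \<le> y"
  \<comment> \<open>In terms of \<open>B\<^sub>k(z) = (k - p) / (k + z)\<close> this is \<open>B\<^sub>k(x) - B\<^sub>k(y)\<close> for \<open>k = i + p\<close>.\<close>
  define c where "c i = real i * (y - x) / ((real (i + p) + x) * (real (i + p) + y))" for i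
  define g where "g i = f (gauss_branch p i y)" for i
  define e where "e i = gauss_weight p i x * (f (gauss_branch p i x) - f (gauss_branch p i y))
      + c (Suc i) * (g i - g (Suc i))" for i
  have weight_diff: "gauss_weight p i x - gauss_weight p i y = c (Suc i) - c i" for i
  proof -
    define k where "k = real (i + p)"
    have k: "k + z > 0" if "z \<in> {0..1}" for z
      using p that by (auto simp: k_def add_pos_nonneg)
    have w: "gauss_weight p i z = (real i + 1) / (k + 1 + z) - real i / (k + z)" if "z \<in> {0..1}" for z
    proof -
      have "real p + z = (real i + 1) * (k + z) - real i * (k + z + 1)"
        by (simp add: k_def algebra_simps)
      then show ?thesis
        using k[OF that] unfolding gauss_weight_def k_def[symmetric]
        by (simp add: diff_frac_eq algebra_simps)
    qed
    have c: "c i = real i / (k + x) - real i / (k + y)"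
      using k[OF x] k[OF y] unfolding c_def k_def[symmetric]
      by (simp add: diff_frac_eq algebra_simps)
    have cS: "c (Suc i) = (real i + 1) / (k + 1 + x) - (real i + 1) / (k + 1 + y)"
    proof -
      have "real (Suc i + p) = k + 1" "real (Suc i) = real i + 1" by (auto simp: k_def)
      then show ?thesis
        using k[OF x] k[OF y] unfolding c_def
        by (simp add: diff_frac_eq algebra_simps)
    qed
    show ?thesis unfolding w[OF x] w[OF y] c cS by simp
  qed
  have split: "gauss_weight p i x * f (gauss_branch p i x) - gauss_weight p i y * f (gauss_branch p i y)
      = e i + (c (Suc i) * g (Suc i) - c i * g i)" for i
  proof -
    have wx: "gauss_weight p i x = gauss_weight p i y + (c (Suc i) - c i)"
      using weight_diff[of i] by simp
    show ?thesis unfolding e_def wx g_def by (simp add: algebra_simps)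
  qed
  have "c \<longlonglongrightarrow> 0"
    unfolding c_def by real_asymp
  then have "(\<lambda>i. \<bar>c i\<bar> * B) \<longlonglongrightarrow> 0"
    by (intro tendsto_mult_left_zero tendsto_rabs_zero)
  moreover have "\<forall>i. norm (c i * g i) \<le> \<bar>c i\<bar> * B"
    using B gauss_branch_in_unit[OF p] y by (simp add: g_def abs_mult mult_left_mono)
  ultimately have "(\<lambda>i. c i * g i) \<longlonglongrightarrow> 0"
    by (rule Lim_null_comparison[OF always_eventually, rotated])
  then have tel: "(\<lambda>i. c (Suc i) * g (Suc i) - c i * g i) sums 0"
    using telescope_sums[of "\<lambda>i. c i * g i" 0] by (simp add: c_def)
  have "(\<lambda>i. gauss_weight p i x * f (gauss_branch p i x) - gauss_weight p i y * f (gauss_branch p i y)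
      - (c (Suc i) * g (Suc i) - c i * g i)) sums (gauss_op p f x - gauss_op p f y - 0)"
    by (intro sums_diff tel gauss_op_sums[OF p _ B] x y)
  then have e_sums: "e sums (gauss_op p f x - gauss_op p f y)"
    by (simp add: split)
  have e_bound: "\<bar>e i\<bar> \<le> (L * (y - x)) * lip_coeff p i 0" for i
  proof -
    define a where "a = real (i + p) + x"
    define b where "b = real (i + p) + y"
    have a: "a > 0" using p x by (auto simp: a_def add_pos_nonneg)
    have ab: "a \<le> b" using xy by (simp add: a_def b_def)
    then have b: "b > 0" using a by simp
    have d: "y - x = b - a" by (simp add: a_def b_def)
    have lip: "\<bar>f u - f v\<bar> \<le> L * \<bar>u - v\<bar>" if "u \<in> {0..1}" "v \<in> {0..1}" for u v
      using lipschitz_onD[OF L that] by (simp add: dist_real_def)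
    have gb: "gauss_branch p i x = real p / a" "gauss_branch p i y = real p / b"
        "gauss_branch p (Suc i) y = real p / (b + 1)"
      by (auto simp: gauss_branch_def a_def b_def add_ac)
    have w: "gauss_weight p i x = (real p + x) / (a * (a + 1))"
      by (simp add: gauss_weight_def a_def)
    have cS: "c (Suc i) = (real i + 1) * (b - a) / ((a + 1) * (b + 1))"
      by (simp add: c_def a_def b_def algebra_simps)
    have "\<bar>gauss_weight p i x * (f (gauss_branch p i x) - f (gauss_branch p i y))\<bar>
        \<le> (real p + x) / (a * (a + 1)) * (L * (real p / a - real p / b))"
    proof -
      have "\<bar>f (gauss_branch p i x) - f (gauss_branch p i y)\<bar> \<le> L * \<bar>real p / a - real p / b\<bar>"
        using lip gauss_branch_in_unit[OF p] x y unfolding gb[symmetric] by auto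
      moreover have "real p / b \<le> real p / a" using a ab by (intro divide_left_mono) auto
      ultimately have "\<bar>f (gauss_branch p i x) - f (gauss_branch p i y)\<bar> \<le> L * (real p / a - real p / b)"
        by simp
      then show ?thesis unfolding abs_mult w
        using a x by (intro mult_mono) auto
    qed
    also have "\<dots> = L * (b - a) * (real p * ((real p + x) / (a ^ 2 * (a + 1) * b)))"
      using a b by (simp add: divide_simps power2_eq_square) (simp add: algebra_simps)
    also have "\<dots> \<le> L * (b - a) * (real p * ((real p + x) / (a ^ 3 * (a + 1))))"
    proof -
      have "a ^ 3 * (a + 1) \<le> a ^ 2 * (a + 1) * b"
        using a ab by (simp add: power2_eq_square power3_eq_cube mult_ac mult_left_mono)
      then show ?thesis
        using a b ab L0 x by (intro mult_left_mono divide_left_mono) auto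
    qed
    finally have 1: "\<bar>gauss_weight p i x * (f (gauss_branch p i x) - f (gauss_branch p i y))\<bar> \<le> \<dots>" .
    have "\<bar>c (Suc i) * (g i - g (Suc i))\<bar>
        \<le> (real i + 1) * (b - a) / ((a + 1) * (b + 1)) * (L * (real p / b - real p / (b + 1)))"
    proof -
      have "\<bar>g i - g (Suc i)\<bar> \<le> L * \<bar>real p / b - real p / (b + 1)\<bar>"
        using lip gauss_branch_in_unit[OF p] x y unfolding g_def gb[symmetric] by auto
      moreover have "real p / (b + 1) \<le> real p / b" using b by (intro divide_left_mono) auto
      ultimately have "\<bar>g i - g (Suc i)\<bar> \<le> L * (real p / b - real p / (b + 1))"
        by simp
      then show ?thesis unfolding abs_mult cS
        using a b ab by (intro mult_mono) auto
    qed
    also have "\<dots> = L * (b - a) * (real p * ((real i + 1) / (b * (b + 1) ^ 2 * (a + 1))))"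
    proof -
      have "real p / b - real p / (b + 1) = real p / (b * (b + 1))"
        using b by (simp add: diff_frac_eq algebra_simps)
      then show ?thesis by (simp add: power2_eq_square mult_ac)
    qed
    also have "\<dots> \<le> L * (b - a) * (real p * ((real i + 1) / (a * (a + 1) ^ 3)))"
    proof -
      have "a * (a + 1) ^ 2 * (a + 1) \<le> b * (b + 1) ^ 2 * (a + 1)"
        using a ab by (intro mult_right_mono mult_mono power_mono) auto
      then have "a * (a + 1) ^ 3 \<le> b * (b + 1) ^ 2 * (a + 1)"
        by (simp add: power2_eq_square power3_eq_cube mult_ac)
      then show ?thesis
        using a b ab L0 by (intro mult_left_mono divide_left_mono) auto
    qed
    finally have 2: "\<bar>c (Suc i) * (g i - g (Suc i))\<bar> \<le> \<dots>" .
    have "\<bar>e i\<bar> \<le> L * (b - a) * lip_coeff p i x"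
      unfolding e_def lip_coeff_def a_def[symmetric]
      using 1 2 by (simp add: distrib_left)
    also have "\<dots> \<le> L * (b - a) * lip_coeff p i 0"
      using lip_coeff_le[OF p] x L0 ab by (intro mult_left_mono) auto
    finally show ?thesis by (simp add: d)
  qed
  have "norm (suminf e) \<le> (\<Sum>i. (L * (y - x)) * lip_coeff p i 0)"
    using e_bound lip_coeff_0_sums[OF p]
    by (intro norm_suminf_le summable_mult) (auto simp: sums_iff)
  also have "\<dots> = L * (y - x) * gauss_rate p"
    using lip_coeff_0_sums[OF p] by (intro sums_unique[symmetric] sums_mult)
  finally show "dist (gauss_op p f x) (gauss_op p f y) \<le> gauss_rate p * L * dist x y"
    using sums_unique[OF e_sums] xy by (simp add: dist_real_def mult_ac)
qed

section \<open>The distribution of the iterates\<close>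

lemma borel_measurable_gauss_map: "gauss_map p \<in> borel_measurable borel"
  unfolding gauss_map_def frac_def by measurable

lemma borel_measurable_gauss_map_funpow: "gauss_map p ^^ n \<in> borel_measurable borel"
proof (induction n)
  case (Suc n)
  then show ?case
    using measurable_comp[OF Suc borel_measurable_gauss_map[of p]] by (simp add: o_def)
qed simp

lemma gauss_map_in_unit: "gauss_map p x \<in> {0..1}"
  by (simp add: gauss_map_def frac_lt_1 less_imp_le)

lemma gauss_map_funpow_in_unit: "x \<in> {0..1} \<Longrightarrow> (gauss_map p ^^ n) x \<in> {0..1}"
  by (cases n) (use gauss_map_in_unit in auto)

definition gauss_law :: "nat \<Rightarrow> nat \<Rightarrow> real measure" where
  "gauss_law p n = distr (lebesgue_on {0..1}) borel (gauss_map p ^^ n)"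

lemma sets_gauss_law [simp]: "sets (gauss_law p n) = sets borel"
  by (simp add: gauss_law_def)

lemma space_gauss_law [simp]: "space (gauss_law p n) = UNIV"
  by (simp add: gauss_law_def)

lemma measurable_lebesgue_on_gauss_map_funpow:
  "gauss_map p ^^ n \<in> borel_measurable (lebesgue_on {0..1})"
  by (intro measurable_restrict_space1 measurable_completion)
    (use borel_measurable_gauss_map_funpow in simp)

lemma finite_measure_gauss_law: "finite_measure (gauss_law p n)"
  unfolding gauss_law_def
  by (intro finite_measure.finite_measure_distr finite_measure_lebesgue_on
      measurable_lebesgue_on_gauss_map_funpow) simp

lemma measure_gauss_law:
  "A \<in> sets borel \<Longrightarrow>
     measure (gauss_law p n) A = measure (lebesgue_on {0..1}) ((gauss_map p ^^ n) -` A \<inter> {0..1})"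
  unfolding gauss_law_def
  using measurable_lebesgue_on_gauss_map_funpow by (subst measure_distr) auto

lemma measure_gauss_law_Suc:
  assumes "A \<in> sets borel"
  shows "measure (gauss_law p (Suc n)) A = measure (gauss_law p n) (gauss_map p -` A)"
proof -
  have "gauss_map p -` A \<in> sets borel"
    using measurable_sets[OF borel_measurable_gauss_map assms] by simp
  moreover have "(gauss_map p ^^ Suc n) -` A = (gauss_map p ^^ n) -` (gauss_map p -` A)"
    by auto
  ultimately show ?thesis
    using assms by (simp add: measure_gauss_law)
qed

lemma measure_gauss_law_Int_unit:
  assumes "A \<in> sets borel"
  shows "measure (gauss_law p n) A = measure (gauss_law p n) (A \<inter> {0..1})"
proof -
  have "(gauss_map p ^^ n) -` A \<inter> {0..1} = (gauss_map p ^^ n) -` (A \<inter> {0..1}) \<inter> {0..1}"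
    using gauss_map_funpow_in_unit by blast
  then show ?thesis
    using assms by (simp add: measure_gauss_law)
qed

text \<open>A point \<open>x \<noteq> 0\<close> is determined by its image \<open>y\<close> and the integer part \<open>k\<close> of \<open>p / x\<close>, as
  \<open>x = p / (k + y)\<close>. This is how the laws are seen to have no atoms.\<close>
lemma countable_gauss_map_vimage:
  assumes "p \<ge> 1" "countable A"
  shows "countable (gauss_map p -` A)"
proof (rule countable_subset)
  show "gauss_map p -` A \<subseteq> insert 0 ((\<lambda>(k, y). real p / (of_int k + y)) ` (UNIV \<times> A))"
  proof
    fix x assume x: "x \<in> gauss_map p -` A"
    show "x \<in> insert 0 ((\<lambda>(k, y). real p / (of_int k + y)) ` (UNIV \<times> A))"
    proof (cases "x = 0")
      case False
      then have "frac (real p / x) \<in> A"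
        using x by (simp add: gauss_map_def)
      moreover have "x = real p / (of_int \<lfloor>real p / x\<rfloor> + frac (real p / x))"
        using False assms(1) by (simp add: frac_def)
      ultimately show ?thesis
        by (intro insertI2 image_eqI[where x = "(\<lfloor>real p / x\<rfloor>, frac (real p / x))"]) auto
    qed simp
  qed
  show "countable (insert 0 ((\<lambda>(k, y). real p / (of_int k + y)) ` (UNIV \<times> A)))"
    using assms by (intro countable_insert countable_image countable_SIGMA) auto
qed


lemma measure_gauss_law_countable:
  assumes "p \<ge> 1" "countable A"
  shows "measure (gauss_law p n) A = 0"
  using assms(2)
proof (induction n arbitrary: A)
  case 0
  have "measure (gauss_law p 0) A = measure lebesgue (A \<inter> {0..1})"
    using 0 by (simp add: measure_gauss_law sets.countable measure_restrict_space)
  also have "\<dots> = 0"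
    using 0 by (intro measure_eq_0_null_sets null_sets_completionI countable_imp_null_set_lborel) auto
  finally show ?case .
next
  case (Suc n)
  then show ?case
    by (simp add: measure_gauss_law_Suc sets.countable countable_gauss_map_vimage[OF assms(1)])
qed

lemma gauss_distr_eq_law: "gauss_distr p n x = measure (gauss_law p n) {0..x}"
  by (simp add: gauss_distr_def measure_gauss_law)

lemma gauss_distr_0: "p \<ge> 1 \<Longrightarrow> gauss_distr p n 0 = 0"
  using measure_gauss_law_countable[of p "{0}" n] by (simp add: gauss_distr_eq_law)

lemma gauss_distr_1: "gauss_distr p n 1 = 1"
proof -
  have "(gauss_map p ^^ n) -` {0..1} \<inter> {0..1} = {0..1}"
    using gauss_map_funpow_in_unit by blast
  then show ?thesis
    by (simp add: gauss_distr_def measure_restrict_space)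
qed

lemma gauss_distr_initial: "x \<in> {0..1} \<Longrightarrow> gauss_distr p 0 x = x"
  by (simp add: gauss_distr_def measure_restrict_space min_def)

lemma measure_gauss_law_Ioc:
  assumes "0 \<le> a" "a \<le> b"
  shows "measure (gauss_law p n) {a<..b} = gauss_distr p n b - gauss_distr p n a"
proof -
  interpret finite_measure "gauss_law p n" by (rule finite_measure_gauss_law)
  have "{a<..b} = {0..b} - {0..a}" using assms by auto
  then show ?thesis
    using finite_measure_Diff[of "{0..b}" "{0..a}"] assms by (simp add: gauss_distr_eq_law)
qed

text \<open>The fractional part of \<open>p / y\<close> is below \<open>x\<close> iff \<open>k \<le> p / y < k + x\<close> for some \<open>k \<ge> p\<close>, that is, iff \<open>y\<close> lies in
  one of the intervals between \<open>p / (k + x)\<close> and \<open>p / k\<close>. With the strict inequality these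
  intervals are disjoint even for \<open>x = 1\<close>; the points where the fractional part equals \<open>x\<close> form a
  countable set, which is null.\<close>
lemma gauss_distr_Suc_sums:
  assumes p: "p \<ge> 1" and x: "x \<in> {0..1}"
  shows "(\<lambda>i. gauss_distr p n (gauss_branch p i 0) - gauss_distr p n (gauss_branch p i x))
           sums gauss_distr p (Suc n) x"
proof -
  interpret finite_measure "gauss_law p n" by (rule finite_measure_gauss_law)
  define A where "A i = {gauss_branch p i x<..gauss_branch p i 0}" for i
  define S where "S = gauss_map p -` {0..x} \<inter> {0..1}"
  have memA: "y \<in> A i \<longleftrightarrow> y > 0 \<and> real (i + p) \<le> real p / y \<and> real p / y < real (i + p) + x" for y i
  proof (cases "y > 0")
    case True
    then show ?thesis using p x by (auto simp: A_def gauss_branch_def field_simps)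
  next
    case False
    moreover have "gauss_branch p i x > 0"
      using p x by (auto simp: gauss_branch_def add_pos_nonneg)
    ultimately show ?thesis by (auto simp: A_def)
  qed
  have floorA: "\<lfloor>real p / y\<rfloor> = int (i + p)" if "y \<in> A i" for y i
    using that x by (intro floor_unique) (auto simp: memA)
  have "disjoint_family A"
    unfolding disjoint_family_on_def
  proof (intro ballI impI)
    fix i j :: nat assume "i \<noteq> j"
    then show "A i \<inter> A j = {}" using floorA[of _ i] floorA[of _ j] by fastforce
  qed
  moreover have "range A \<subseteq> sets (gauss_law p n)"
    by (auto simp: A_def)
  ultimately have "(\<lambda>i. measure (gauss_law p n) (A i)) sums measure (gauss_law p n) (\<Union>i. A i)"
    by (intro finite_measure_UNION)
  moreover have "measure (gauss_law p n) (A i)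
      = gauss_distr p n (gauss_branch p i 0) - gauss_distr p n (gauss_branch p i x)" for i
    unfolding A_def using p x
    by (intro measure_gauss_law_Ioc) (auto simp: gauss_branch_def intro!: divide_left_mono)
  moreover have "measure (gauss_law p n) (\<Union>i. A i) = gauss_distr p (Suc n) x"
  proof -
    have sub: "(\<Union>i. A i) \<subseteq> S"
    proof
      fix y assume "y \<in> (\<Union>i. A i)"
      then obtain i where y: "y \<in> A i" by blast
      then have "y > 0" "real p \<le> real p / y" "frac (real p / y) \<le> x"
        using floorA[OF y] by (auto simp: memA frac_def)
      moreover from this have "y \<le> 1"
        using p by (simp add: le_divide_eq)
      ultimately show "y \<in> S"
        by (simp add: S_def gauss_map_def)
    qed
    have "S - (\<Union>i. A i) \<subseteq> insert 0 (gauss_map p -` {x})"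
    proof
      fix y assume y: "y \<in> S - (\<Union>i. A i)"
      show "y \<in> insert 0 (gauss_map p -` {x})"
      proof (rule ccontr)
        assume "y \<notin> insert 0 (gauss_map p -` {x})"
        then have y0: "0 < y" "y \<le> 1" "frac (real p / y) < x"
          using y by (auto simp: S_def gauss_map_def)
        have "real p \<le> real p / y"
          using y0 by (simp add: le_divide_eq mult_left_le)
        then have "int p \<le> \<lfloor>real p / y\<rfloor>" by (simp add: le_floor_iff)
        then obtain i where "\<lfloor>real p / y\<rfloor> = int (i + p)"
          by (metis zle_iff_zadd add.commute of_nat_add)
        then have "y \<in> A i"
          using y0 by (simp add: memA frac_def) linarith
        then show False using y by blast
      qed
    qed
    from countable_subset[OF this] have "countable (S - (\<Union>i. A i))"
      by (simp add: countable_gauss_map_vimage[OF p])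
    then have "measure (gauss_law p n) ((\<Union>i. A i) \<union> (S - (\<Union>i. A i))) = measure (gauss_law p n) (\<Union>i. A i)"
      using measure_gauss_law_countable[OF p]
      by (intro measure_zero_union) (auto simp: A_def intro: sets.countable)
    moreover have "(\<Union>i. A i) \<union> (S - (\<Union>i. A i)) = S" using sub by blast
    moreover have "gauss_distr p (Suc n) x = measure (gauss_law p n) S"
    proof -
      have "gauss_map p -` {0..x} \<in> sets borel"
        using measurable_sets[OF borel_measurable_gauss_map, of "{0..x}"] by simp
      then show ?thesis
        unfolding gauss_distr_eq_law S_def
        by (simp add: measure_gauss_law_Suc flip: measure_gauss_law_Int_unit)
    qed
    ultimately show ?thesis by simp
  qed
  ultimately show ?thesis by simp
qed

section \<open>The density relative to the invariant measure\<close>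

lemma has_real_derivative_gauss_distr_initial:
  assumes "p \<ge> 1" "x \<in> {0..1}"
  shows "(gauss_distr p 0 has_real_derivative (real p + x) / (real p + x)) (at x within {0..1})"
proof (rule has_field_derivative_transform_within[of "\<lambda>x. x"])
  show "((\<lambda>x. x) has_real_derivative (real p + x) / (real p + x)) (at x within {0..1})"
    using assms by (auto intro!: derivative_eq_intros)
  show "y = gauss_distr p 0 y" if "y \<in> {0..1}" for y
    using gauss_distr_initial[OF that] by simp
qed (use assms in \<open>auto intro: zero_less_one\<close>)

lemma has_real_derivative_gauss_branch:
  assumes "p \<ge> 1" "x \<in> {0..1}"
  shows "(gauss_branch p i has_real_derivative - real p / (real (i + p) + x) ^ 2) (at x within {0..1})"
proof -
  have "real (i + p) + x > 0" using assms by (auto simp: add_pos_nonneg)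
  then show ?thesis
    unfolding gauss_branch_def
    by (auto intro!: derivative_eq_intros simp: power2_eq_square)
qed

text \<open>Differentiate the recursion for the distribution functions term by term. The factor
  \<open>p / (k + x)\<^sup>2\<close> from the branch and the density \<open>1 / (p + u\<^sub>k(x))\<close> combine to \<open>1 / ((k + x) (k + x + 1))\<close>,
  which is \<open>P\<^sub>k(x) / (p + x)\<close>; as \<open>f\<close> is bounded, the derivatives are dominated by a multiple of
  \<open>1 / k\<^sup>2\<close>.\<close>
lemma has_real_derivative_gauss_distr_Suc:
  assumes p: "p \<ge> 1" and bound: "\<And>y. y \<in> {0..1} \<Longrightarrow> \<bar>f y\<bar> \<le> B"
    and deriv: "\<And>y. y \<in> {0..1} \<Longrightarrow>
      (gauss_distr p n has_real_derivative f y / (real p + y)) (at y within {0..1})"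
    and x: "x \<in> {0..1}"
  shows "(gauss_distr p (Suc n) has_real_derivative gauss_op p f x / (real p + x)) (at x within {0..1})"
proof -
  define F where "F = gauss_distr p n"
  define t where "t i y = F (gauss_branch p i 0) - F (gauss_branch p i y)" for i y
  define t' where "t' i y = gauss_weight p i y * f (gauss_branch p i y) / (real p + y)" for i y
  have deriv_t: "(t i has_real_derivative t' i y) (at y within {0..1})" if y: "y \<in> {0..1}" for i y
  proof -
    define b where "b = gauss_branch p i y"
    have b: "b \<in> {0..1}" using gauss_branch_in_unit[OF p] y by (simp add: b_def)
    have "gauss_branch p i ` {0..1} \<subseteq> {0..1}"
      using gauss_branch_in_unit[OF p] by auto
    then have "(F has_real_derivative f b / (real p + b)) (at b within gauss_branch p i ` {0..1})"
      using deriv[OF b] unfolding F_def by (rule DERIV_subset[rotated])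
    then have "(F \<circ> gauss_branch p i has_real_derivative
        f b / (real p + b) * (- real p / (real (i + p) + y) ^ 2)) (at y within {0..1})"
      unfolding b_def by (rule DERIV_image_chain) (rule has_real_derivative_gauss_branch[OF p y])
    then have "((\<lambda>z. F (gauss_branch p i 0) - (F \<circ> gauss_branch p i) z) has_real_derivative
        0 - f b / (real p + b) * (- real p / (real (i + p) + y) ^ 2)) (at y within {0..1})"
      by (intro DERIV_diff DERIV_const)
    moreover have "0 - f b / (real p + b) * (- real p / (real (i + p) + y) ^ 2) = t' i y"
    proof -
      define k where "k = real (i + p) + y"
      have k: "k > 0" using p y by (auto simp: k_def add_pos_nonneg)
      have "b = real p / k" by (simp add: b_def gauss_branch_def k_def)
      then have pb: "real p + b = real p * (k + 1) / k"
        using k by (simp add: field_simps)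
      have w: "gauss_weight p i y / (real p + y) = 1 / (k * (k + 1))"
        using p y by (simp add: gauss_weight_def k_def)
      have "0 - f b / (real p + b) * (- real p / k ^ 2) = f b * (1 / (k * (k + 1)))"
        unfolding pb using p k by (simp add: power2_eq_square)
      also have "\<dots> = t' i y"
        unfolding w[symmetric] t'_def b_def by simp
      finally show ?thesis by (simp add: k_def)
    qed
    ultimately show ?thesis
      by (simp add: t_def[abs_def] o_def)
  qed
  have t'_bound: "norm (t' i y) \<le> (real p + 1) * B * (1 / real (i + p) ^ 2)" if y: "y \<in> {0..1}" for i y
  proof -
    have "norm (t' i y) \<le> \<bar>gauss_weight p i y * f (gauss_branch p i y)\<bar> / 1"
      unfolding t'_def real_norm_def abs_divide using p y by (intro divide_left_mono) auto
    also have "\<dots> \<le> (real p + 1) * B * (1 / real (i + p) ^ 2)"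
      using gauss_op_term_bound[OF p y bound] by simp
    finally show ?thesis .
  qed
  have t'_suminf: "(\<Sum>i. t' i y) = gauss_op p f y / (real p + y)" if "y \<in> {0..1}" for y
    unfolding t'_def
    by (intro sums_unique[symmetric] sums_divide gauss_op_sums[OF p that bound])
  have "uniform_limit {0..1} (\<lambda>m y. \<Sum>i<m. t' i y) (\<lambda>y. \<Sum>i. t' i y) sequentially"
    using p by (intro Weierstrass_m_test[OF t'_bound] summable_mult summable_hurwitz_zeta_nat) auto
  moreover have t_sums: "(\<lambda>i. t i y) sums gauss_distr p (Suc n) y" if "y \<in> {0..1}" for y
    unfolding t_def F_def using gauss_distr_Suc_sums[OF p that] .
  ultimately have "\<exists>G. \<forall>y\<in>{0..1}. (\<lambda>i. t i y) sums G y \<and>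
      (G has_real_derivative (\<Sum>i. t' i y)) (at y within {0..1})"
    using has_field_derivative_series[of "{0..1}" t t' "\<lambda>y. \<Sum>i. t' i y" x] deriv_t x
      sums_summable[OF t_sums[OF x]] by simp
  then obtain G where
    G: "\<And>y. y \<in> {0..1} \<Longrightarrow> (\<lambda>i. t i y) sums G y"
       "\<And>y. y \<in> {0..1} \<Longrightarrow> (G has_real_derivative (\<Sum>i. t' i y)) (at y within {0..1})"
    by blast
  have "G y = gauss_distr p (Suc n) y" if "y \<in> {0..1}" for y
    using sums_unique2[OF G(1)[OF that] t_sums[OF that]] .
  then show ?thesis
    using has_field_derivative_transform_within[OF G(2)[OF x] zero_less_one x, of "gauss_distr p (Suc n)"]
      t'_suminf[OF x] by simp
qed

lemma gauss_distr_lipschitz_density: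
  assumes p: "p \<ge> 1"
  shows "\<exists>f. (gauss_rate p ^ n)-lipschitz_on {0..1} f \<and>
    (\<forall>x\<in>{0..1}. (gauss_distr p n has_real_derivative f x / (real p + x)) (at x within {0..1}))"
proof (induction n)
  case 0
  have "1-lipschitz_on {0..1} (\<lambda>x. real p + x)"
    by (intro lipschitz_onI) (auto simp: dist_real_def)
  then show ?case
    using has_real_derivative_gauss_distr_initial[OF p] by (intro exI[of _ "\<lambda>x. real p + x"]) auto
next
  case (Suc n)
  then obtain f where f: "(gauss_rate p ^ n)-lipschitz_on {0..1} f"
    and deriv: "\<And>x. x \<in> {0..1} \<Longrightarrow>
      (gauss_distr p n has_real_derivative f x / (real p + x)) (at x within {0..1})"
    by blast
  obtain B where B: "\<And>y. y \<in> {0..1} \<Longrightarrow> \<bar>f y\<bar> \<le> B"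
    using lipschitz_on_unit_bounded[OF f] by blast
  have "(gauss_rate p ^ Suc n)-lipschitz_on {0..1} (gauss_op p f)"
    using gauss_op_lipschitz[OF p f] by simp
  then show ?case
    using has_real_derivative_gauss_distr_Suc[OF p B deriv] by blast
qed

text \<open>Cauchy's mean value theorem for \<open>F\<close> and \<open>ln (q + y)\<close>, with one-sided derivatives at the ends
  of \<open>[0,1]\<close>. The constant \<open>c\<close> makes \<open>G\<close> take the same value at \<open>0\<close> and \<open>x\<close>.\<close>
lemma mean_value_log:
  assumes q: "q > 0" and x: "0 < x" "x \<le> 1"
    and deriv: "\<And>y. y \<in> {0..1} \<Longrightarrow> (F has_real_derivative f y / (q + y)) (at y within {0..1})"
  obtains \<xi> where "\<xi> \<in> {0..1}" "F x - F 0 = f \<xi> * (ln (q + x) - ln q)"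
proof -
  define \<Lambda> where "\<Lambda> = ln (q + x) - ln q"
  define c where "c = (F x - F 0) / \<Lambda>"
  have \<Lambda>: "\<Lambda> > 0" using q x by (simp add: \<Lambda>_def)
  define G where "G y = F y - c * ln (q + y)" for y
  have "(G has_real_derivative (f y - c) / (q + y)) (at y within {0..x})" if y: "0 \<le> y" "y \<le> x" for y
  proof -
    have "(F has_real_derivative f y / (q + y)) (at y within {0..x})"
      by (rule DERIV_subset[OF deriv]) (use x y in auto)
    moreover have "((\<lambda>y. c * ln (q + y)) has_real_derivative c / (q + y)) (at y within {0..x})"
      using q y by (auto intro!: derivative_eq_intros simp: divide_simps)
    ultimately show ?thesis
      unfolding G_def diff_divide_distrib by (rule DERIV_diff)
  qed
  then obtain \<xi> where \<xi>: "\<xi> \<in> {0<..<x}" "G x - G 0 = (f \<xi> - c) / (q + \<xi>) * (x - 0)"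
    using mvt_simple[OF x(1), of G "\<lambda>y. (*) ((f y - c) / (q + y))"]
    unfolding has_field_derivative_def by blast
  have "G x - G 0 = F x - F 0 - c * \<Lambda>"
    by (simp add: G_def \<Lambda>_def algebra_simps)
  also have "\<dots> = 0" using \<Lambda> by (simp add: c_def)
  finally have "f \<xi> = c" using \<xi> x q by auto
  then show ?thesis
    using that[of \<xi>] \<xi>(1) x \<Lambda> by (auto simp: c_def \<Lambda>_def)
qed

section \<open>Convergence of the distribution functions\<close>

theorem theorem1:
  fixes p :: nat
  assumes "p \<ge> 1"
  shows "gauss_rate p < 1 / (2 * real p) + 3 / (8 * real p ^ 2) \<and>
         1 / (2 * real p) + 3 / (8 * real p ^ 2) < 1 \<and>
         (\<forall>x\<in>{0..1}. \<exists>C. \<forall>n.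
            \<bar>gauss_distr p n x - gauss_limit p x\<bar> \<le> C * gauss_rate p ^ n)"
proof (intro conjI ballI)
  show "gauss_rate p < 1 / (2 * real p) + 3 / (8 * real p ^ 2)"
    by (rule gauss_rate_less[OF assms])
  show "1 / (2 * real p) + 3 / (8 * real p ^ 2) < 1"
    by (rule gauss_rate_bound_less_1[OF assms])
  fix x :: real assume x: "x \<in> {0..1}"
  define l where "l y = ln (real p + y) - ln (real p)" for y
  have l1: "l 1 > 0" and lx: "l x \<ge> 0" using assms x by (simp_all add: l_def)
  have "\<bar>gauss_distr p n x - gauss_limit p x\<bar> \<le> l x * gauss_rate p ^ n" for n
  proof (cases "x = 0")
    case True
    then show ?thesis
      using gauss_distr_0[OF assms] by (simp add: gauss_limit_def l_def)
  next
    case False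
    then have x0: "0 < x" "x \<le> 1" using x by auto
    obtain f where f: "(gauss_rate p ^ n)-lipschitz_on {0..1} f"
      and deriv: "\<And>y. y \<in> {0..1} \<Longrightarrow>
        (gauss_distr p n has_real_derivative f y / (real p + y)) (at y within {0..1})"
      using gauss_distr_lipschitz_density[OF assms] by blast
    have q: "real p > 0" using assms by simp
    obtain \<eta> where \<eta>: "\<eta> \<in> {0..1}" "gauss_distr p n x = f \<eta> * l x"
      using mean_value_log[OF q x0 deriv] gauss_distr_0[OF assms] unfolding l_def by auto
    obtain \<xi> where \<xi>: "\<xi> \<in> {0..1}" "1 = f \<xi> * l 1"
      using mean_value_log[OF q _ _ deriv, of 1] gauss_distr_0[OF assms] gauss_distr_1[of p n]
      unfolding l_def by auto
    have "gauss_limit p x = l x / l 1" by (simp add: gauss_limit_def l_def)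
    also have "\<dots> = f \<xi> * l x" using \<xi>(2) l1 by (simp add: field_simps)
    finally have "\<bar>gauss_distr p n x - gauss_limit p x\<bar> = \<bar>f \<eta> - f \<xi>\<bar> * l x"
      using lx \<eta>(2) by (simp add: abs_mult flip: left_diff_distrib)
    also have "\<dots> \<le> (gauss_rate p ^ n * 1) * l x"
    proof (intro mult_right_mono lx)
      have "\<bar>f \<eta> - f \<xi>\<bar> \<le> gauss_rate p ^ n * \<bar>\<eta> - \<xi>\<bar>"
        using lipschitz_onD[OF f \<eta>(1) \<xi>(1)] by (simp add: dist_real_def)
      also have "\<dots> \<le> gauss_rate p ^ n * 1"
        using \<eta>(1) \<xi>(1) gauss_rate_nonneg[OF assms] by (intro mult_left_mono) auto
      finally show "\<bar>f \<eta> - f \<xi>\<bar> \<le> gauss_rate p ^ n * 1" .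
    qed
    finally show ?thesis by (simp add: mult.commute)
  qed
  then show "\<exists>C. \<forall>n. \<bar>gauss_distr p n x - gauss_limit p x\<bar> \<le> C * gauss_rate p ^ n"
    by blast
qed

end
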